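(* Let $p$ be a prime, $q$ a power of $p$, $K=\mathbb{F}_q(T)$, $A=\mathbb{F}_q[T]$, $d\geq2$ an integer with $p\nmid d$, and $a\in K^\times\setminus\mathbb{F}_q$. If $f=\mathrm{ord}_d(q)\geq2$, then the set $R_q(a,d)$ has no $d_1$-density and no $d_2$-density.
   Context: $\mathcal{P}_+$ is the set of monic irreducible polynomials of $A$, and $I_N$ the number of them of degree $N$. $R_q(a,d)$ is the set of $P\in\mathcal{P}_+$ with $v_P(a)=0$ and $d$ dividing the multiplicative order of $a$ in $(A/P)^\times$. For $S\subseteq\mathcal{P}_+$, $S(N)$ is the number of elements of $S$ of degree $N$; the $d_1$-density is $d_1(S)=\lim_{N\to\infty}S(N)/I_N$ and the $d_2$-density is $d_2(S)=\lim_{N\to\infty}\sum_{n=1}^N S(n)\big/\sum_{n=1}^N I_n$, when these limits exist. *)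

theory Defs
  imports
    "HOL-Algebra.Algebraic_Closure_Type"
    "HOL-Number_Theory.Number_Theory"
    "HOL-Library.Cardinality"
begin

text \<open>
  The field \<open>\<F>\<^sub>q\<close> is a type \<open>'a\<close> of class \<open>{field, finite}\<close> with \<open>CARD('a) = q\<close>. Then \<open>A\<close> is
  \<open>'a poly\<close> and \<open>K\<close> is its fraction field \<open>'a poly fract\<close>.
\<close>

definition monic_irreducibles :: "'a::{field, finite} poly set" where
  "monic_irreducibles = {P. lead_coeff P = 1 \<and> Factorial_Ring.irreducible P}"

definition const_field :: "'a::{field, finite} poly fract set" where
  "const_field = range (\<lambda>c. Fraction_Field.Fract [:c:] 1)"

text \<open>
  The valuation at \<open>P\<close> is the exponent \<open>v\<close> in \<open>a = P\<^sup>v x / y\<close> with \<open>x\<close> and \<open>y\<close> polynomials not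
  divisible by \<open>P\<close>; this determines \<open>v\<close> for irreducible \<open>P\<close> and \<open>a \<noteq> 0\<close>. The value
  \<open>v\<^sub>P(0) = \<infinity>\<close> is not represented.
\<close>

definition val :: "'a::{field, finite} poly \<Rightarrow> 'a poly fract \<Rightarrow> int" where
  "val P a = (THE v. \<exists>x y. \<not> P dvd x \<and> \<not> P dvd y \<and>
                a = Fraction_Field.Fract P 1 powi v * Fraction_Field.Fract x y)"

definition residue_ring_at :: "'a::{field, finite} poly \<Rightarrow> 'a poly set ring" where
  "residue_ring_at P =
     ring_of_type_algebra Quot (PIdl\<^bsub>ring_of_type_algebra\<^esub> P)"

definition poly_class :: "'a::{field, finite} poly \<Rightarrow> 'a poly \<Rightarrow> 'a poly set" where
  "poly_class P x =
     (PIdl\<^bsub>ring_of_type_algebra\<^esub> P) +>\<^bsub>ring_of_type_algebra\<^esub> x"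

text \<open>
  The reduction modulo \<open>P\<close> of an element \<open>a\<close> of \<open>K\<close> that is integral at \<open>P\<close>: if \<open>a = x / y\<close> with
  \<open>P\<close> not dividing \<open>y\<close>, it is the class of \<open>x\<close> times the inverse of the class of \<open>y\<close> in \<open>A/P\<close>.
  For irreducible \<open>P\<close> this does not depend on the choice of \<open>x\<close> and \<open>y\<close>.
\<close>

definition reduction :: "'a::{field, finite} poly \<Rightarrow> 'a poly fract \<Rightarrow> 'a poly set" where
  "reduction P a = (THE c. \<exists>x y. \<not> P dvd y \<and> a = Fraction_Field.Fract x y \<and>
     c = poly_class P x \<otimes>\<^bsub>residue_ring_at P\<^esub> inv\<^bsub>residue_ring_at P\<^esub> (poly_class P y))"

definition R_set :: "'a::{field, finite} poly fract \<Rightarrow> nat \<Rightarrow> 'a poly set" where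
  "R_set a d = {P \<in> monic_irreducibles. val P a = 0 \<and>
     d dvd group.ord (units_of (residue_ring_at P)) (reduction P a)}"

definition deg_count :: "'a::{field, finite} poly set \<Rightarrow> nat \<Rightarrow> nat" where
  "deg_count S N = card {P \<in> S. Polynomial.degree P = N}"

definition has_d1_density :: "'a::{field, finite} poly set \<Rightarrow> real \<Rightarrow> bool" where
  "has_d1_density S \<delta> \<longleftrightarrow>
     (\<lambda>N. real (deg_count S N) / real (deg_count (monic_irreducibles :: 'a poly set) N))
       \<longlonglongrightarrow> \<delta>"

definition has_d2_density :: "'a::{field, finite} poly set \<Rightarrow> real \<Rightarrow> bool" where
  "has_d2_density S \<delta> \<longleftrightarrow>
     (\<lambda>N. real (\<Sum>n=1..N. deg_count S n) /
          real (\<Sum>n=1..N. deg_count (monic_irreducibles :: 'a poly set) n))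
       \<longlonglongrightarrow> \<delta>"

end

theory Submission
  imports Defs
begin

text \<open>
  Since \<open>(A/P)\<^sup>\<times>\<close> has order \<open>q\<^sup>N - 1\<close> for \<open>P\<close> of degree \<open>N\<close>, membership in \<open>R\<^sub>q(a,d)\<close> forces \<open>f | N\<close>,
  up to the finitely many degrees of primes at which numerator or denominator of \<open>a\<close> vanishes. So
  both densities could only be \<open>0\<close>; for \<open>d\<^sub>2\<close> this uses that the primes of degree exactly \<open>N\<close> are a
  proportion bounded below of those of degree at most \<open>N\<close>, so that the quotient drops by a fixed
  factor at every \<open>N\<close> not divisible by \<open>f\<close>. It remains to see that \<open>R\<^sub>q(a,d)\<close> contains at least half of the
  primes of degree \<open>N\<close> for infinitely many \<open>N\<close>.

  No equidistribution theorem is needed for this. Take \<open>N = f d\<^sup>j\<close>, so that \<open>d\<^sup>j\<^sup>+\<^sup>1\<close> divides \<open>q\<^sup>N - 1\<close>.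
  If \<open>d\<close> does not divide the order of \<open>a = u/v\<close> modulo \<open>P\<close>, then that order divides
  \<open>m = (q\<^sup>N - 1) / l\<^sup>j\<close> for some prime \<open>l | d\<close>, hence \<open>P\<close> divides \<open>u\<^sup>m - v\<^sup>m\<close>. This polynomial is nonzero
  because \<open>a\<close> is not constant, and its degree is \<open>O(q\<^sup>N / 2\<^sup>j)\<close>, so it has only \<open>O(q\<^sup>N / (2\<^sup>j N))\<close>
  prime factors of degree \<open>N\<close>, a small proportion of the roughly \<open>q\<^sup>N / N\<close> primes of that degree.
\<close>

section \<open>Residue rings\<close>

text \<open>Phrased through coefficients rather than \<open>degree\<close>, so that the zero
  polynomial is included and n = 0 makes sense. In the induction \<open>pCons\<close> splits off the
  constant coefficient.\<close>

lemma card_polys_degree_less: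
  "finite {x :: 'a::{field, finite} poly. \<forall>i\<ge>n. poly.coeff x i = 0} \<and>
   card {x :: 'a poly. \<forall>i\<ge>n. poly.coeff x i = 0} = CARD('a) ^ n"
proof (induction n)
  case 0
  have "{x :: 'a poly. \<forall>i\<ge>0. poly.coeff x i = 0} = {0}"
    by (auto simp: poly_eq_iff)
  then show ?case by simp
next
  case (Suc n)
  let ?D = "\<lambda>n. {x :: 'a poly. \<forall>i\<ge>n. poly.coeff x i = 0}"
  let ?g = "\<lambda>(c, x). pCons c (x :: 'a poly)"
  have eq: "?D (Suc n) = ?g ` (UNIV \<times> ?D n)"
  proof (intro equalityI subsetI)
    fix x assume x: "x \<in> ?D (Suc n)"
    obtain c y where xy: "x = pCons c y" by (rule pCons_cases)
    have "poly.coeff y i = 0" if "i \<ge> n" for i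
    proof -
      have "poly.coeff x (Suc i) = 0" using x that by simp
      then show ?thesis by (simp add: xy)
    qed
    then show "x \<in> ?g ` (UNIV \<times> ?D n)" using xy by (auto intro!: image_eqI[of _ _ "(c, y)"])
  qed (auto simp: coeff_pCons split: nat.splits)
  have inj: "inj_on ?g (UNIV \<times> ?D n)" by (auto simp: inj_on_def)
  show ?case
    unfolding eq using Suc by (simp add: card_image[OF inj] card_cartesian_product)
qed

lemma in_PIdl_iff:
  fixes P :: "'a::{field, finite} poly"
  shows "x \<in> PIdl\<^bsub>ring_of_type_algebra\<^esub> P \<longleftrightarrow> P dvd x"
  by (auto simp: cgenideal_def ring_of_type_algebra_def dvd_def mult.commute)

lemma poly_class_eq_iff:
  fixes P :: "'a::{field, finite} poly"
  shows "poly_class P x = poly_class P y \<longleftrightarrow> P dvd x - y"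
proof -
  have *: "poly_class P x = {h + x |h. P dvd h}" for x
  proof -
    have "PIdl\<^bsub>ring_of_type_algebra\<^esub> P = {h. P dvd h}" by (auto simp: in_PIdl_iff)
    then show ?thesis
      unfolding poly_class_def a_r_coset_def' by (auto simp: ring_of_type_algebra_def)
  qed
  show ?thesis
  proof
    assume "poly_class P x = poly_class P y"
    moreover have "x \<in> poly_class P x" unfolding * by force
    ultimately show "P dvd x - y" unfolding * by auto
  next
    assume d: "P dvd x - y"
    have "{h + x |h. P dvd h} \<subseteq> {h + y |h. P dvd h}" if "P dvd x - y" for x y
    proof clarify
      fix h assume "P dvd h"
      with that show "\<exists>k. h + x = k + y \<and> P dvd k"
        by (intro exI[of _ "h + (x - y)"]) auto
    qed
    moreover have "P dvd y - x" using d by (subst dvd_diff_commute)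
    ultimately show "poly_class P x = poly_class P y" unfolding * using d by blast
  qed
qed

lemma degree_irreducible_pos:
  fixes P :: "'a::field poly"
  assumes "Factorial_Ring.irreducible P"
  shows "0 < Polynomial.degree P"
  using assms
  by (metis Factorial_Ring.irreducible_def bot_nat_0.not_eq_extremum is_unit_iff_degree)

locale residue_field =
  fixes P :: "'a::{field, finite} poly"
  assumes irr: "Factorial_Ring.irreducible P"
begin

abbreviation "R \<equiv> residue_ring_at P"
abbreviation "cls \<equiv> poly_class P"

lemma prime_elem: "Factorial_Ring.prime_elem P"
  using irr by (rule field_poly_irreducible_imp_prime)

lemma not_dvd_1: "\<not> P dvd 1"
  using irr by (auto simp: Factorial_Ring.irreducible_def)

lemma primeideal: "primeideal (PIdl\<^bsub>ring_of_type_algebra\<^esub> P) ring_of_type_algebra"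
proof (rule primeidealI)
  show "cring (ring_of_type_algebra :: 'a poly ring)"
    by (rule cring_from_type_algebra)
  then show "ideal (PIdl\<^bsub>ring_of_type_algebra\<^esub> P) ring_of_type_algebra"
    by (rule cring.cgenideal_ideal) (simp add: ring_of_type_algebra_def)
  show "carrier ring_of_type_algebra \<noteq> PIdl\<^bsub>ring_of_type_algebra\<^esub> P"
    using not_dvd_1 in_PIdl_iff[of 1 P] by (auto simp: ring_of_type_algebra_def)
  show "x \<in> PIdl\<^bsub>ring_of_type_algebra\<^esub> P \<or> y \<in> PIdl\<^bsub>ring_of_type_algebra\<^esub> P"
    if "x \<otimes>\<^bsub>ring_of_type_algebra\<^esub> y \<in> PIdl\<^bsub>ring_of_type_algebra\<^esub> P" for x y
    using that prime_elem_dvd_multD[OF prime_elem, of x y]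
    unfolding in_PIdl_iff by (simp add: ring_of_type_algebra_def)
qed

sublocale domain R
  unfolding residue_ring_at_def by (rule primeideal.quotient_is_domain[OF primeideal])

lemma cls_hom: "ring_hom_cring ring_of_type_algebra R cls"
  using primeideal.rcos_ring_hom_cring[OF primeideal]
  by (simp add: residue_ring_at_def poly_class_def[abs_def])

sublocale hom: ring_hom_cring "ring_of_type_algebra :: 'a poly ring" R cls
  by (rule cls_hom)

lemma cls_closed [simp]: "cls x \<in> carrier R"
  using hom.hom_closed[of x] by (simp add: ring_of_type_algebra_def)

lemma cls_mult: "cls (x * y) = cls x \<otimes>\<^bsub>R\<^esub> cls y"
  using hom.hom_mult[of x y] by (simp add: ring_of_type_algebra_def)

lemma cls_one: "cls 1 = \<one>\<^bsub>R\<^esub>"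
  using hom.hom_one by (simp add: ring_of_type_algebra_def)

lemma cls_zero: "cls 0 = \<zero>\<^bsub>R\<^esub>"
  using hom.hom_zero by (simp add: ring_of_type_algebra_def)

lemma cls_power: "cls (x ^ n) = cls x [^]\<^bsub>R\<^esub> (n::nat)"
  by (induction n) (simp_all add: cls_one cls_mult mult.commute[of x])

lemma cls_eq_zero_iff: "cls x = \<zero>\<^bsub>R\<^esub> \<longleftrightarrow> P dvd x"
  using poly_class_eq_iff[of P x 0] by (simp add: cls_zero)

lemma carrier_eq: "carrier R = range cls"
  by (auto simp: residue_ring_at_def FactRing_def A_RCOSETS_def' poly_class_def ring_of_type_algebra_def)

text \<open>Remainders modulo \<open>P\<close> represent every residue class exactly once, so the
  carrier is in bijection with the polynomials of degree below that of \<open>P\<close>.\<close>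

lemma finite_carrier: "finite (carrier R)"
  and card_carrier: "card (carrier R) = CARD('a) ^ Polynomial.degree P"
proof -
  let ?D = "{x :: 'a poly. \<forall>i\<ge>Polynomial.degree P. poly.coeff x i = 0}"
  have P0: "P \<noteq> 0" using irr by auto
  have "range cls \<subseteq> cls ` ?D"
  proof clarify
    fix x
    have "poly.coeff (x mod P) i = 0" if "i \<ge> Polynomial.degree P" for i
      using degree_mod_less[OF P0, of x] that by (auto intro: coeff_eq_0)
    moreover have "cls x = cls (x mod P)"
      by (simp add: poly_class_eq_iff minus_mod_eq_mult_div)
    ultimately show "cls x \<in> cls ` ?D" by blast
  qed
  then have eq: "carrier R = cls ` ?D" using carrier_eq by auto
  have "inj_on cls ?D"
  proof (rule inj_onI)
    fix x y assume x: "x \<in> ?D" and y: "y \<in> ?D" and "cls x = cls y"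
    then have d: "P dvd x - y" by (simp add: poly_class_eq_iff)
    show "x = y"
    proof (rule ccontr)
      assume "x \<noteq> y"
      then have "Polynomial.degree P \<le> Polynomial.degree (x - y)"
        using d dvd_imp_degree_le[of P "x - y"] by simp
      then have "poly.coeff (x - y) (Polynomial.degree (x - y)) = 0" using x y by simp
      then show False using \<open>x \<noteq> y\<close> by (simp only: leading_coeff_0_iff) simp
    qed
  qed
  then show "finite (carrier R)" "card (carrier R) = CARD('a) ^ Polynomial.degree P"
    using card_polys_degree_less[of "Polynomial.degree P", where 'a = 'a]
    by (simp_all add: eq card_image)
qed

text \<open>A finite domain is a field: multiplication by a nonzero element is injective, hence
  surjective, and so reaches 1.\<close>

sublocale field R
proof (rule cring_fieldI)
  show "Units R = carrier R - {\<zero>\<^bsub>R\<^esub>}"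
  proof (intro equalityI subsetI)
    fix x assume x: "x \<in> carrier R - {\<zero>\<^bsub>R\<^esub>}"
    have inj: "inj_on (\<lambda>y. x \<otimes>\<^bsub>R\<^esub> y) (carrier R)"
      using x by (intro inj_onI) (metis DiffE m_lcancel insertCI)
    have "(\<lambda>y. x \<otimes>\<^bsub>R\<^esub> y) ` carrier R = carrier R"
      using finite_carrier _ inj by (rule endo_inj_surj) (use x in auto)
    then have "\<one>\<^bsub>R\<^esub> \<in> (\<lambda>y. x \<otimes>\<^bsub>R\<^esub> y) ` carrier R" by simp
    then obtain y where "y \<in> carrier R" "\<one>\<^bsub>R\<^esub> = x \<otimes>\<^bsub>R\<^esub> y" by blast
    then show "x \<in> Units R"
      using x m_comm[of x y] by (auto simp: Units_def intro!: bexI[of _ y])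
  next
    fix x assume x: "x \<in> Units R"
    then have "x \<noteq> \<zero>\<^bsub>R\<^esub>" using zero_not_one by (auto simp: Units_def)
    then show "x \<in> carrier R - {\<zero>\<^bsub>R\<^esub>}" using x Units_closed by blast
  qed
qed

sublocale units: group "units_of R"
  by (rule units_group)

lemma order_units: "Coset.order (units_of R) = CARD('a) ^ Polynomial.degree P - 1"
  using finite_carrier
  by (simp add: Coset.order_def units_of_carrier field_Units card_carrier)

lemma cls_in_units_iff: "cls x \<in> carrier (units_of R) \<longleftrightarrow> \<not> P dvd x"
  by (simp add: units_of_carrier field_Units cls_eq_zero_iff)

lemma units_pow: "x \<in> carrier (units_of R) \<Longrightarrow> x [^]\<^bsub>units_of R\<^esub> (n::nat) = x [^]\<^bsub>R\<^esub> n"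
  by (induction n) (simp_all add: units_of_one units_of_mult)

text \<open>Lagrange in the unit group, multiplied by \<open>x\<close> so that multiples of
  \<open>P\<close> are covered too.\<close>

lemma dvd_power_card_minus: "P dvd x ^ (CARD('a) ^ Polynomial.degree P) - x"
proof (cases "P dvd x")
  case True
  have "x dvd x ^ (CARD('a) ^ Polynomial.degree P)" by simp
  then show ?thesis using True by (metis dvd_diff dvd_trans)
next
  case False
  let ?n = "CARD('a) ^ Polynomial.degree P"
  have "cls x [^]\<^bsub>units_of R\<^esub> (?n - 1) = \<one>\<^bsub>units_of R\<^esub>"
    using units.pow_order_eq_1[of "cls x"] False order_units by (simp add: cls_in_units_iff)
  then have "cls (x ^ (?n - 1)) = cls 1"
    using False by (simp add: units_pow cls_in_units_iff units_of_one cls_power cls_one)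
  then have "P dvd (x ^ (?n - 1) - 1) * x" by (simp add: poly_class_eq_iff)
  moreover have "x ^ ?n = x ^ (?n - 1) * x"
    by (metis power_minus_mult zero_less_card_finite zero_less_power)
  ultimately show ?thesis by (simp add: algebra_simps)
qed



lemma ex_units_generator:
  "\<exists>g\<in>carrier R - {\<zero>\<^bsub>R\<^esub>}. \<forall>y\<in>carrier R - {\<zero>\<^bsub>R\<^esub>}. \<exists>i::nat. y = g [^]\<^bsub>R\<^esub> i"
proof (rule bexE[OF finite_field_mult_group_has_gen[OF finite_carrier, unfolded Multiplicative_Group.carrier_mult_of]])
  fix g assume g: "g \<in> carrier R - {\<zero>\<^bsub>R\<^esub>}"
    and eq: "carrier R - {\<zero>\<^bsub>R\<^esub>} = {g [^]\<^bsub>R\<^esub> i |i::nat. i \<in> UNIV}"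
  show ?thesis
  proof (rule bexI[OF _ g], rule ballI)
    fix y assume "y \<in> carrier R - {\<zero>\<^bsub>R\<^esub>}"
    then show "\<exists>i::nat. y = g [^]\<^bsub>R\<^esub> i" unfolding eq by simp
  qed
qed

text \<open>The unit group of A/P is cyclic. If raising to the power q^r is the identity on A/P, a
  generator has order dividing q^r - 1, so A/P has at most q^r elements.\<close>

lemma degree_le_of_power_fixed:
  assumes "\<And>x. P dvd x ^ (CARD('a) ^ r) - x" and "0 < r"
  shows "Polynomial.degree P \<le> r"
proof -
  obtain g where g: "g \<in> carrier R - {\<zero>\<^bsub>R\<^esub>}"
    "\<And>y. y \<in> carrier R - {\<zero>\<^bsub>R\<^esub>} \<Longrightarrow> \<exists>i::nat. y = g [^]\<^bsub>R\<^esub> i"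
    using ex_units_generator by blast
  obtain x where x: "g = cls x" using g(1) carrier_eq by auto
  have card2: "2 \<le> CARD('a)"
    using card_mono[of "UNIV :: 'a set" "{0, 1}"] by simp
  let ?m = "CARD('a) ^ r - 1"
  have m: "0 < ?m" using one_less_power[of "CARD('a)" r] card2 \<open>0 < r\<close> by linarith
  have gu: "g \<in> carrier (units_of R)" using g(1) by (simp add: units_of_carrier field_Units)
  have "P dvd (x ^ ?m - 1) * x"
  proof -
    have "x ^ (CARD('a) ^ r) = x ^ ?m * x"
      by (metis power_minus_mult zero_less_card_finite zero_less_power)
    then show ?thesis using assms(1)[of x] by (simp add: algebra_simps)
  qed
  moreover have "\<not> P dvd x" using gu x cls_in_units_iff by simp
  ultimately have "P dvd x ^ ?m - 1" using prime_elem_dvd_multD[OF prime_elem] by blast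
  then have "g [^]\<^bsub>R\<^esub> ?m = \<one>\<^bsub>R\<^esub>"
    using x poly_class_eq_iff[of P "x ^ ?m" 1] by (simp add: cls_power cls_one)
  then have g1: "g [^]\<^bsub>units_of R\<^esub> ?m = \<one>\<^bsub>units_of R\<^esub>"
    using gu by (simp add: units_pow units_of_one)
  have "carrier R - {\<zero>\<^bsub>R\<^esub>} \<subseteq> (\<lambda>i. g [^]\<^bsub>R\<^esub> i) ` {..<?m}"
  proof
    fix y assume "y \<in> carrier R - {\<zero>\<^bsub>R\<^esub>}"
    then obtain i :: nat where y: "y = g [^]\<^bsub>R\<^esub> i" using g(2) by blast
    have "g [^]\<^bsub>units_of R\<^esub> i = g [^]\<^bsub>units_of R\<^esub> (i mod ?m)"
      using gu g1 units.nat_pow_mult[of g "?m * (i div ?m)" "i mod ?m"]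
      by (simp add: units.nat_pow_pow[symmetric])
    then have "y = g [^]\<^bsub>R\<^esub> (i mod ?m)" using y gu by (simp add: units_pow)
    then show "y \<in> (\<lambda>i. g [^]\<^bsub>R\<^esub> i) ` {..<?m}" using m by simp
  qed
  then have "card (carrier R - {\<zero>\<^bsub>R\<^esub>}) \<le> ?m"
    by (metis card_lessThan finite_lessThan surj_card_le)
  then have "CARD('a) ^ Polynomial.degree P - 1 \<le> CARD('a) ^ r - 1"
    using finite_carrier by (simp add: card_carrier)
  then have "CARD('a) ^ Polynomial.degree P \<le> CARD('a) ^ r"
    using zero_less_power[OF zero_less_card_finite[where 'a = 'a], of r] by linarith
  then show ?thesis using card2 by simp
qed

end

section \<open>Counting irreducible polynomials\<close>

lemma monic_irreducible_dvd_imp_eq: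
  assumes "P \<in> monic_irreducibles" "Q \<in> monic_irreducibles" "P dvd Q"
  shows "P = Q"
proof -
  obtain r where r: "Q = P * r" using assms(3) by (elim dvdE)
  have "\<not> P dvd 1" using assms(1) by (auto simp: monic_irreducibles_def Factorial_Ring.irreducible_def)
  then have "r dvd 1"
    using assms(2) irreducibleD[of Q P r] r by (auto simp: monic_irreducibles_def)
  then obtain c where c: "r = [:c:]" by (elim is_unit_polyE)
  have "Polynomial.lead_coeff Q = Polynomial.lead_coeff P * Polynomial.lead_coeff r"
    by (simp add: r Polynomial.lead_coeff_mult)
  then have "c = 1" using assms c by (simp add: monic_irreducibles_def)
  then show ?thesis using r c by (simp add: one_pCons[symmetric])
qed

lemma monic_irreducible_imp_prime_elem:
  "P \<in> monic_irreducibles \<Longrightarrow> Factorial_Ring.prime_elem P"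
  by (auto simp: monic_irreducibles_def intro: field_poly_irreducible_imp_prime)

section \<open>Products of distinct monic irreducibles and degree bounds\<close>

lemma prime_elem_dvd_prodD:
  assumes "Factorial_Ring.prime_elem P" "finite S" "P dvd \<Prod>S"
  shows "\<exists>Q\<in>S. P dvd Q"
  using assms(2,3)
proof (induction S)
  case empty
  then show ?case using assms(1) by (simp add: Factorial_Ring.prime_elem_def)
next
  case (insert Q S)
  then show ?case using prime_elem_dvd_multD[OF assms(1), of Q "\<Prod>S"] by auto
qed

lemma prod_monic_irreducibles_dvd:
  assumes "finite S" "S \<subseteq> monic_irreducibles" "\<And>P. P \<in> S \<Longrightarrow> P dvd G"
  shows "\<Prod>S dvd G"
  using assms
proof (induction S)
  case (insert P S)
  then obtain H where H: "G = \<Prod>S * H" by (auto simp: dvd_def)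
  have "\<not> P dvd \<Prod>S"
  proof
    assume "P dvd \<Prod>S"
    then obtain Q where "Q \<in> S" "P dvd Q"
      using prime_elem_dvd_prodD[OF monic_irreducible_imp_prime_elem, of P S] insert by auto
    then show False
      using monic_irreducible_dvd_imp_eq[of P Q] insert by auto
  qed
  moreover have "P dvd \<Prod>S * H" using insert.prems H by auto
  ultimately have "P dvd H"
    using prime_elem_dvd_multD[OF monic_irreducible_imp_prime_elem, of P "\<Prod>S" H] insert.prems by blast
  then show ?case using insert.hyps H by (simp add: mult_dvd_mono mult.commute[of P])
qed simp

lemma monic_irreducible_nonzero: "P \<in> monic_irreducibles \<Longrightarrow> P \<noteq> 0"
  by (auto simp: monic_irreducibles_def)

lemma degree_prod_monic_irreducibles:
  assumes "finite S" "S \<subseteq> monic_irreducibles"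
  shows "Polynomial.degree (\<Prod>S) = (\<Sum>P\<in>S. Polynomial.degree P)"
  using assms monic_irreducible_nonzero
  by (subst Polynomial.degree_prod_eq_sum_degree) auto

lemma finite_monic_irreducibles_degree:
  "finite {P \<in> monic_irreducibles :: 'a::{field, finite} poly set. Polynomial.degree P \<le> N}"
proof (rule finite_subset)
  show "finite {x :: 'a poly. \<forall>i\<ge>Suc N. poly.coeff x i = 0}"
    using card_polys_degree_less by blast
qed (auto intro: coeff_eq_0)

lemma finite_monic_irreducible_divisors:
  assumes "G \<noteq> 0"
  shows "finite {P \<in> monic_irreducibles. P dvd G}"
  by (rule finite_subset[OF _ finite_monic_irreducibles_degree[of "Polynomial.degree G"]])
    (auto dest: dvd_imp_degree_le[OF _ assms])

lemma sum_degree_monic_irreducible_divisors_le: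
  assumes "S \<subseteq> {P \<in> monic_irreducibles. P dvd G}" "G \<noteq> 0"
  shows "(\<Sum>P\<in>S. Polynomial.degree P) \<le> Polynomial.degree G"
proof -
  have fin: "finite S"
    using finite_subset[OF assms(1) finite_monic_irreducible_divisors[OF assms(2)]] .
  have sub: "S \<subseteq> monic_irreducibles" using assms(1) by auto
  have "\<Prod>S dvd G" using prod_monic_irreducibles_dvd[OF fin sub] assms(1) by auto
  then show ?thesis
    using dvd_imp_degree_le[OF _ assms(2)] degree_prod_monic_irreducibles[OF fin sub] by metis
qed

text \<open>Used twice: with G = T^(q^N) - T it bounds I_N from above, and with G = u^m - v^m it
  bounds the number of primes of degree N outside \<open>R_set\<close>.\<close>

lemma card_monic_irreducible_divisors_le:
  assumes "G \<noteq> 0"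
  shows "N * card {P \<in> monic_irreducibles. P dvd G \<and> Polynomial.degree P = N} \<le> Polynomial.degree G"
  using sum_degree_monic_irreducible_divisors_le[of "{P \<in> monic_irreducibles. P dvd G \<and> Polynomial.degree P = N}" G]
    assms by (auto simp: mult.commute)

text \<open>A divisor of least positive degree is irreducible; dividing by its leading coefficient
  makes it monic.\<close>

lemma ex_monic_irreducible_factor:
  fixes H :: "'a::{field, finite} poly"
  assumes "0 < Polynomial.degree H"
  shows "\<exists>P \<in> monic_irreducibles. P dvd H"
proof -
  define D where "D = {x. x dvd H \<and> 0 < Polynomial.degree x}"
  obtain P where P: "P \<in> D" and min: "\<And>x. x \<in> D \<Longrightarrow> Polynomial.degree P \<le> Polynomial.degree x"
    using ex_has_least_nat[of "\<lambda>x. x \<in> D" H Polynomial.degree] assms by (auto simp: D_def)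
  have P0: "P \<noteq> 0" using P by (auto simp: D_def)
  have "Factorial_Ring.irreducible P"
  proof (rule irreducibleI)
    show "P \<noteq> 0" by fact
    show "\<not> is_unit P" using P by (auto simp: D_def is_unit_iff_degree[OF P0])
    fix x y assume xy: "P = x * y"
    then have nz: "x \<noteq> 0" "y \<noteq> 0" using P0 by auto
    then have deg: "Polynomial.degree P = Polynomial.degree x + Polynomial.degree y"
      by (simp add: xy Polynomial.degree_mult_eq)
    have "x dvd H" using P xy by (auto simp: D_def intro: dvd_trans)
    show "is_unit x \<or> is_unit y"
    proof (cases "Polynomial.degree x = 0")
      case True then show ?thesis using nz by (simp add: is_unit_iff_degree)
    next
      case False
      then have "x \<in> D" using \<open>x dvd H\<close> by (auto simp: D_def)
      from min[OF this] deg have "Polynomial.degree y = 0" by simp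
      then show ?thesis using nz by (simp add: is_unit_iff_degree)
    qed
  qed
  moreover define c where "c = inverse (Polynomial.lead_coeff P)"
  ultimately have "Factorial_Ring.irreducible (Polynomial.smult c P)"
    using P0 irreducible_mult_unit_left[of "[:c:]" P] by (simp add: is_unit_pCons_iff)
  moreover have "Polynomial.lead_coeff (Polynomial.smult c P) = 1" using P0 by (simp add: c_def)
  moreover have "Polynomial.smult c P dvd H" using P P0 by (simp add: D_def c_def smult_dvd_iff)
  ultimately show ?thesis
    by (intro bexI[of _ "Polynomial.smult c P"]) (simp_all only: monic_irreducibles_def mem_Collect_eq)
qed

text \<open>After division by the product of the distinct prime divisors, a nonconstant cofactor
  \<open>H\<close> would have a prime factor whose square divides \<open>G\<close>.\<close>

lemma sum_degree_monic_irreducible_divisors_eq: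
  fixes G :: "'a::{field, finite} poly"
  assumes "G \<noteq> 0" and sqf: "\<And>P. P \<in> monic_irreducibles \<Longrightarrow> \<not> P * P dvd G"
  shows "(\<Sum>P | P \<in> monic_irreducibles \<and> P dvd G. Polynomial.degree P) = Polynomial.degree G"
proof -
  let ?S = "{P \<in> monic_irreducibles. P dvd G}"
  have fin: "finite ?S" by (rule finite_monic_irreducible_divisors[OF assms(1)])
  obtain H where H: "G = \<Prod>?S * H"
    using prod_monic_irreducibles_dvd[OF fin, of G] by (auto simp: dvd_def)
  have "Polynomial.degree H = 0"
  proof (rule ccontr)
    assume "Polynomial.degree H \<noteq> 0"
    then obtain P where P: "P \<in> monic_irreducibles" "P dvd H"
      using ex_monic_irreducible_factor[of H] by auto
    then have "P \<in> ?S" using H by (metis (no_types, lifting) dvd_mult mem_Collect_eq)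
    then have "P dvd \<Prod>?S" using fin by (rule dvd_prodI[rotated])
    then have "P * P dvd G" using P(2) by (subst H) (rule mult_dvd_mono)
    then show False using sqf P(1) by blast
  qed
  moreover have "\<Prod>?S \<noteq> 0" "H \<noteq> 0" using H assms(1) by auto
  ultimately have "Polynomial.degree G = Polynomial.degree (\<Prod>?S)"
    by (subst H) (simp add: Polynomial.degree_mult_eq)
  then show ?thesis using degree_prod_monic_irreducibles[OF fin] by auto
qed

section \<open>The polynomial T^(q^N) - T\<close>

lemma two_le_CARD: "2 \<le> CARD('a::{field, finite})"
  using card_mono[of "UNIV :: 'a set" "{0, 1}"] by simp

lemma CHAR_dvd_CARD_power:
  "0 < N \<Longrightarrow> of_nat (CARD('a) ^ N) = (0 :: 'a::{field, finite})"
  by (metis CHAR_dvd_CARD dvd_power dvd_trans of_nat_eq_0_iff_char_dvd)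

lemma degree_Frobenius_poly:
  assumes "0 < N"
  shows "Polynomial.degree (Polynomial.monom 1 (CARD('a) ^ N) - [:0, 1 :: 'a::{field, finite}:])
    = CARD('a) ^ N"
proof -
  have "1 < CARD('a) ^ N"
    using one_less_power[of "CARD('a)" N] two_le_CARD[where 'a = 'a] assms by linarith
  then have "Polynomial.degree [:0, 1 :: 'a:] < Polynomial.degree (Polynomial.monom (1 :: 'a) (CARD('a) ^ N))"
    by (simp add: Polynomial.degree_monom_eq)
  then show ?thesis
    using Polynomial.degree_add_eq_left[of "- [:0, 1 :: 'a:]" "Polynomial.monom 1 (CARD('a) ^ N)"]
    unfolding diff_conv_add_uminus by (simp add: Polynomial.degree_monom_eq)
qed

text \<open>The derivative of T^(q^N) - T is -1, since q^N vanishes in the field, whereas a square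
  factor \<open>P * P\<close> would force \<open>P\<close> to divide the derivative.\<close>

lemma Frobenius_poly_squarefree:
  fixes P :: "'a::{field, finite} poly"
  assumes "0 < N" "P \<in> monic_irreducibles"
  shows "\<not> P * P dvd Polynomial.monom 1 (CARD('a) ^ N) - [:0, 1:]" (is "\<not> _ dvd ?G")
proof
  assume "P * P dvd ?G"
  then obtain H where "?G = P * P * H" by (elim dvdE)
  then have "pderiv ?G = P * (pderiv P * H + (pderiv P * H + P * pderiv H))"
    by (simp add: pderiv_mult algebra_simps)
  then have "P dvd pderiv ?G" by simp
  moreover have "pderiv ?G = - 1"
    using CHAR_dvd_CARD_power[OF assms(1), where 'a = 'a]
    by (simp add: pderiv_diff pderiv_monom pderiv_pCons one_pCons del: of_nat_power)
  ultimately have "P dvd 1" by simp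
  then show False
    using assms(2) by (auto simp: monic_irreducibles_def Factorial_Ring.irreducible_def)
qed

text \<open>The residue field at P = T is the field of constants, so this is Lagrange there, read
  off by evaluation at 0.\<close>

lemma field_power_CARD:
  fixes c :: "'a::{field, finite}"
  shows "c ^ CARD('a) = c"
proof -
  interpret residue_field "[:0, 1 :: 'a:]"
    by standard (simp add: irreducible_linear_field_poly)
  have "[:0, 1:] dvd [:c:] ^ CARD('a) - [:c:]"
    using dvd_power_card_minus[of "[:c:]"] by simp
  then show ?thesis by (simp add: dvd_iff_poly_eq_0)
qed

lemma field_power_CARD_power:
  fixes c :: "'a::{field, finite}"
  shows "c ^ (CARD('a) ^ N) = c"
  by (induction N) (simp_all add: power_mult field_power_CARD)

context
  fixes k :: nat
  assumes CARD_eq: "CARD('a::{field, finite}) = CHAR('a) ^ k"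
begin

text \<open>Raising to the power q^N is additive because q^N is a power of the characteristic, it
  fixes constants, and modulo \<open>P\<close> it fixes T by assumption. Hence it fixes every
  polynomial modulo \<open>P\<close>.\<close>

lemma Frobenius_fixed:
  fixes P x :: "'a poly"
  assumes "P dvd Polynomial.monom 1 (CARD('a) ^ N) - [:0, 1:]"
  shows "P dvd x ^ (CARD('a) ^ N) - x"
proof (induction x)
  case 0
  then show ?case by (simp add: zero_power)
next
  case (pCons c x)
  let ?Q = "CARD('a) ^ N"
  let ?T = "[:0, 1:] :: 'a poly"
  have pr: "Factorial_Ring.prime CHAR('a poly)"
    using prime_CHAR_semidom[where 'a = 'a] finite_imp_CHAR_pos[where 'a = 'a] by simp
  have split: "pCons c x = [:c:] + ?T * x" by simp
  have Q: "?Q = CHAR('a poly) ^ (k * N)" using CARD_eq by (simp add: power_mult)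
  have "(pCons c x) ^ ?Q = [:c:] ^ ?Q + (?T * x) ^ ?Q"
    unfolding split by (rule freshmans_dream'[OF pr Q])
  also have "[:c:] ^ ?Q = [:c:]" by (simp add: poly_const_pow field_power_CARD_power)
  also have "(?T * x) ^ ?Q = Polynomial.monom 1 ?Q * x ^ ?Q"
    by (simp only: power_mult_distrib monom_altdef smult_1_left)
  finally have "(pCons c x) ^ ?Q - pCons c x
      = (Polynomial.monom 1 ?Q - ?T) * x ^ ?Q + ?T * (x ^ ?Q - x)"
    by (simp add: algebra_simps)
  then show ?case using assms pCons.IH by (metis dvd_add dvd_mult dvd_mult2)
qed

text \<open>With n the degree of \<open>P\<close>, the powers q^n and q^N both act as the identity
  on A/P, hence so does the power q^(N mod n). A positive remainder would then be at least n by
  \<open>degree_le_of_power_fixed\<close>.\<close>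

lemma degree_dvd_of_dvd_Frobenius_poly:
  fixes P :: "'a poly"
  assumes "P \<in> monic_irreducibles" "P dvd Polynomial.monom 1 (CARD('a) ^ N) - [:0, 1:]"
  shows "Polynomial.degree P dvd N"
proof (rule ccontr)
  let ?n = "Polynomial.degree P"
  interpret residue_field P using assms(1) by unfold_locales (simp add: monic_irreducibles_def)
  assume "\<not> ?n dvd N"
  then have pos: "0 < N mod ?n" by (simp add: mod_greater_zero_iff_not_dvd)
  have np: "0 < ?n" using degree_irreducible_pos irr by blast
  have iter: "P dvd x ^ (CARD('a) ^ (?n * i)) - x" for x i
  proof (induction i)
    case (Suc i)
    have "P dvd (x ^ (CARD('a) ^ (?n * i))) ^ (CARD('a) ^ ?n) - x ^ (CARD('a) ^ (?n * i))"
      by (rule dvd_power_card_minus)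
    from dvd_add[OF this Suc] show ?case by (simp add: power_mult[symmetric] power_add mult.commute)
  qed simp
  have "P dvd x ^ (CARD('a) ^ (N mod ?n)) - x" for x
  proof -
    have "(x ^ (CARD('a) ^ (N mod ?n))) ^ (CARD('a) ^ (?n * (N div ?n))) = x ^ (CARD('a) ^ N)"
      by (simp add: power_mult[symmetric] power_add[symmetric])
    then have "P dvd x ^ (CARD('a) ^ N) - x ^ (CARD('a) ^ (N mod ?n))"
      using iter[of "x ^ (CARD('a) ^ (N mod ?n))" "N div ?n"] by simp
    from dvd_diff[OF Frobenius_fixed[OF assms(2), of x] this] show ?thesis by simp
  qed
  from degree_le_of_power_fixed[OF this pos] have "?n \<le> N mod ?n" .
  then show False using mod_less_divisor[OF np, of N] by linarith
qed

end

section \<open>Upper and lower bounds for the number of primes of degree N\<close>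

lemma degree_count_monic_irreducibles_le:
  assumes "0 < N"
  shows "N * deg_count (monic_irreducibles :: 'a::{field, finite} poly set) N \<le> CARD('a) ^ N"
proof -
  let ?G = "Polynomial.monom 1 (CARD('a) ^ N) - [:0, 1 :: 'a:]"
  have "0 < CARD('a) ^ N" by simp
  then have G0: "?G \<noteq> 0" using degree_Frobenius_poly[OF assms, where 'a = 'a] by force
  have "P dvd ?G" if "P \<in> monic_irreducibles" "Polynomial.degree P = N" for P :: "'a poly"
  proof -
    interpret residue_field P using that(1) by unfold_locales (simp add: monic_irreducibles_def)
    show ?thesis using dvd_power_card_minus[of "[:0, 1:]"] that(2) by (simp add: monom_altdef)
  qed
  then have "{P \<in> monic_irreducibles. Polynomial.degree P = N}
      = {P \<in> monic_irreducibles. P dvd ?G \<and> Polynomial.degree P = N}" by blast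
  then show ?thesis
    using card_monic_irreducible_divisors_le[OF G0, of N] degree_Frobenius_poly[OF assms, where 'a = 'a]
    by (simp add: deg_count_def)
qed

text \<open>The degrees of the prime divisors of T^(q^N) - T add up to q^N. Each such degree divides
  N, so it is N or at most N/2, and the primes of degree n contribute at most q^n by the upper
  bound.\<close>

lemma degree_count_monic_irreducibles_ge:
  assumes "CARD('a::{field, finite}) = CHAR('a) ^ k" "0 < N"
  shows "CARD('a) ^ N \<le> N * deg_count (monic_irreducibles :: 'a poly set) N
    + (\<Sum>n=1..N div 2. CARD('a) ^ n)"
proof -
  let ?G = "Polynomial.monom 1 (CARD('a) ^ N) - [:0, 1 :: 'a:]"
  let ?I = "\<lambda>n. {P \<in> monic_irreducibles :: 'a poly set. Polynomial.degree P = n}"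
  have fin: "finite (?I n)" for n
    by (rule finite_subset[OF _ finite_monic_irreducibles_degree[of n]]) auto
  have "0 < CARD('a) ^ N" by simp
  then have G0: "?G \<noteq> 0" using degree_Frobenius_poly[OF assms(2), where 'a = 'a] by force
  have "{P \<in> monic_irreducibles. P dvd ?G} \<subseteq> (\<Union>n\<in>insert N {1..N div 2}. ?I n)"
  proof clarify
    fix P assume P: "P \<in> monic_irreducibles" "P dvd ?G"
    then have "Polynomial.degree P dvd N" using degree_dvd_of_dvd_Frobenius_poly[OF assms(1)] by blast
    then obtain m where m: "N = Polynomial.degree P * m" by (elim dvdE)
    have "Polynomial.degree P \<in> insert N {1..N div 2}"
    proof (cases "m \<le> 1")
      case True
      then show ?thesis using m assms(2) by (cases m) auto
    next
      case False
      then have "Polynomial.degree P * 2 \<le> N" unfolding m by (intro mult_le_mono) auto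
      moreover have "Polynomial.degree P \<noteq> 0" using m assms(2) by (intro notI) simp
      ultimately show ?thesis by auto
    qed
    then show "P \<in> (\<Union>n\<in>insert N {1..N div 2}. ?I n)" using P by blast
  qed
  then have "(\<Sum>P | P \<in> monic_irreducibles \<and> P dvd ?G. Polynomial.degree P)
      \<le> (\<Sum>P\<in>(\<Union>n\<in>insert N {1..N div 2}. ?I n). Polynomial.degree P)"
    using fin by (intro sum_mono2) auto
  also have "\<dots> = (\<Sum>n\<in>insert N {1..N div 2}. \<Sum>P\<in>?I n. Polynomial.degree P)"
    using fin by (intro sum.UNION_disjoint) auto
  also have "\<dots> = (\<Sum>n\<in>insert N {1..N div 2}. n * deg_count (monic_irreducibles :: 'a poly set) n)"
    by (intro sum.cong) (auto simp: deg_count_def)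
  also have "\<dots> = N * deg_count (monic_irreducibles :: 'a poly set) N
      + (\<Sum>n=1..N div 2. n * deg_count (monic_irreducibles :: 'a poly set) n)"
    using assms(2) by (subst sum.insert) auto
  also have "\<dots> \<le> N * deg_count (monic_irreducibles :: 'a poly set) N + (\<Sum>n=1..N div 2. CARD('a) ^ n)"
    by (intro add_left_mono sum_mono degree_count_monic_irreducibles_le) auto
  finally show ?thesis
    using sum_degree_monic_irreducible_divisors_eq[OF G0 Frobenius_poly_squarefree[OF assms(2)]]
      degree_Frobenius_poly[OF assms(2), where 'a = 'a] by simp
qed

section \<open>Reduction of rational functions\<close>

context residue_field
begin

text \<open>Well-definedness of the description in \<open>reduction\<close>: cross-multiplying two
  representations and cancelling the invertible classes of the denominators gives the same
  residue.\<close>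

lemma reduction_Fract:
  assumes "\<not> P dvd v"
  shows "reduction P (Fraction_Field.Fract u v) = cls u \<otimes>\<^bsub>R\<^esub> inv\<^bsub>R\<^esub> cls v"
  unfolding reduction_def
proof (rule the_equality)
  show "\<exists>x y. \<not> P dvd y \<and> Fraction_Field.Fract u v = Fraction_Field.Fract x y \<and>
      cls u \<otimes>\<^bsub>R\<^esub> inv\<^bsub>R\<^esub> cls v = cls x \<otimes>\<^bsub>R\<^esub> inv\<^bsub>R\<^esub> cls y"
    using assms by blast
next
  fix c assume "\<exists>x y. \<not> P dvd y \<and> Fraction_Field.Fract u v = Fraction_Field.Fract x y \<and>
      c = cls x \<otimes>\<^bsub>R\<^esub> inv\<^bsub>R\<^esub> cls y"
  then obtain x y where y: "\<not> P dvd y" and eq: "Fraction_Field.Fract u v = Fraction_Field.Fract x y"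
    and c: "c = cls x \<otimes>\<^bsub>R\<^esub> inv\<^bsub>R\<^esub> cls y" by blast
  have "v \<noteq> 0" "y \<noteq> 0" using assms y by auto
  with eq have "u * y = x * v" by (simp add: eq_fract)
  then have e: "cls u \<otimes>\<^bsub>R\<^esub> cls y = cls x \<otimes>\<^bsub>R\<^esub> cls v" by (metis cls_mult)
  have uv: "cls v \<in> Units R" and uy: "cls y \<in> Units R"
    using assms y cls_in_units_iff by (auto simp: units_of_carrier)
  have iv: "inv\<^bsub>R\<^esub> cls v \<in> carrier R" and iy: "inv\<^bsub>R\<^esub> cls y \<in> carrier R"
    using uv uy by auto
  have "c = cls x \<otimes>\<^bsub>R\<^esub> inv\<^bsub>R\<^esub> cls y \<otimes>\<^bsub>R\<^esub> (cls v \<otimes>\<^bsub>R\<^esub> inv\<^bsub>R\<^esub> cls v)"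
    using c iy Units_r_inv[OF uv] by simp
  also have "\<dots> = (cls x \<otimes>\<^bsub>R\<^esub> cls v) \<otimes>\<^bsub>R\<^esub> inv\<^bsub>R\<^esub> cls y \<otimes>\<^bsub>R\<^esub> inv\<^bsub>R\<^esub> cls v"
    using iv iy by (simp add: m_ac)
  also have "\<dots> = cls u \<otimes>\<^bsub>R\<^esub> (cls y \<otimes>\<^bsub>R\<^esub> inv\<^bsub>R\<^esub> cls y) \<otimes>\<^bsub>R\<^esub> inv\<^bsub>R\<^esub> cls v"
    unfolding e[symmetric] using iv iy by (simp add: m_assoc)
  also have "\<dots> = cls u \<otimes>\<^bsub>R\<^esub> inv\<^bsub>R\<^esub> cls v"
    using iv Units_r_inv[OF uy] by simp
  finally show "c = cls u \<otimes>\<^bsub>R\<^esub> inv\<^bsub>R\<^esub> cls v" .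
qed

text \<open>A nonzero exponent, after cross-multiplication, would make \<open>P\<close> divide a
  product of two polynomials neither of which it divides.\<close>

lemma val_Fract_eq_0:
  assumes "\<not> P dvd u" "\<not> P dvd v"
  shows "val P (Fraction_Field.Fract u v) = 0"
  unfolding val_def
proof (rule the_equality)
  show "\<exists>x y. \<not> P dvd x \<and> \<not> P dvd y \<and>
      Fraction_Field.Fract u v = Fraction_Field.Fract P 1 powi 0 * Fraction_Field.Fract x y"
    using assms by (intro exI[of _ u] exI[of _ v]) simp
next
  fix w assume "\<exists>x y. \<not> P dvd x \<and> \<not> P dvd y \<and>
      Fraction_Field.Fract u v = Fraction_Field.Fract P 1 powi w * Fraction_Field.Fract x y"
  then obtain x y where xy: "\<not> P dvd x" "\<not> P dvd y"
    and eq: "Fraction_Field.Fract u v = Fraction_Field.Fract P 1 powi w * Fraction_Field.Fract x y"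
    by blast
  have nz: "v \<noteq> 0" "y \<noteq> 0" "P \<noteq> 0" using assms xy irr by auto
  have pw: "Fraction_Field.Fract P 1 ^ n = Fraction_Field.Fract (P ^ n) 1" for n
    by (induction n) (simp_all add: One_fract_def)
  have pw': "Fraction_Field.Fract 1 P ^ n = Fraction_Field.Fract 1 (P ^ n)" for n
    by (induction n) (simp_all add: One_fract_def)
  have nd: "\<not> P dvd s * t" if "\<not> P dvd s" "\<not> P dvd t" for s t
    using that prime_elem_dvd_multD[OF prime_elem] by blast
  show "w = 0"
  proof (rule ccontr)
    assume "w \<noteq> 0"
    then consider "0 < w" | "w < 0" by linarith
    then show False
    proof cases
      case 1
      then have "Fraction_Field.Fract u v = Fraction_Field.Fract (P ^ nat w * x) y"
        using eq by (simp add: power_int_def pw)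
      then have "u * y = P ^ nat w * x * v" using nz by (simp add: eq_fract)
      moreover have "P dvd P ^ nat w" using 1 by simp
      ultimately have "P dvd u * y" by (metis dvd_mult2)
      then show False using nd assms xy by blast
    next
      case 2
      then have "Fraction_Field.Fract u v = Fraction_Field.Fract x (P ^ nat (- w) * y)"
        using eq by (simp add: power_int_def pw')
      then have "u * (P ^ nat (- w) * y) = x * v" using nz by (simp add: eq_fract)
      moreover have "P dvd P ^ nat (- w)" using 2 by simp
      ultimately have "P dvd x * v" by (metis dvd_mult dvd_mult2)
      then show False using nd assms xy by blast
    qed
  qed
qed

text \<open>Multiplying g^m = 1 by the invertible class of v^m turns a condition on the order into
  divisibility of a polynomial, where degrees can be compared.\<close>

lemma ord_reduction_dvd_iff:
  assumes "\<not> P dvd u" "\<not> P dvd v"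
  shows "group.ord (units_of R) (reduction P (Fraction_Field.Fract u v)) dvd m \<longleftrightarrow> P dvd u ^ m - v ^ m"
proof -
  define g where "g = cls u \<otimes>\<^bsub>R\<^esub> inv\<^bsub>R\<^esub> cls v"
  have uu: "cls u \<in> Units R" and uv: "cls v \<in> Units R"
    using assms cls_in_units_iff by (auto simp: units_of_carrier)
  have iv: "inv\<^bsub>R\<^esub> cls v \<in> carrier R" using uv by (rule Units_inv_closed)
  have gU: "g \<in> Units R" unfolding g_def using uu uv by simp
  then have gu: "g \<in> carrier (units_of R)" by (simp add: units_of_carrier)
  have g: "g \<in> carrier R" using gU by (rule Units_closed)
  have "g \<otimes>\<^bsub>R\<^esub> cls v = cls u"
    unfolding g_def using iv Units_l_inv[OF uv] by (simp add: m_assoc)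
  then have "(g \<otimes>\<^bsub>R\<^esub> cls v) [^]\<^bsub>R\<^esub> m = cls u [^]\<^bsub>R\<^esub> m" by simp
  then have e: "g [^]\<^bsub>R\<^esub> m \<otimes>\<^bsub>R\<^esub> cls (v ^ m) = cls (u ^ m)"
    using g by (simp add: nat_pow_distrib cls_power)
  have "\<not> P dvd v ^ m" using assms(2) prime_elem_dvd_power[OF prime_elem] by blast
  then have nz: "cls (v ^ m) \<noteq> \<zero>\<^bsub>R\<^esub>" by (simp add: cls_eq_zero_iff)
  have "units.ord g dvd m \<longleftrightarrow> g [^]\<^bsub>units_of R\<^esub> m = \<one>\<^bsub>units_of R\<^esub>"
    using units.pow_eq_id[OF gu] by simp
  also have "\<dots> \<longleftrightarrow> g [^]\<^bsub>R\<^esub> m = \<one>\<^bsub>R\<^esub>" using gu by (simp add: units_pow units_of_one)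
  also have "\<dots> \<longleftrightarrow> cls (u ^ m) = cls (v ^ m)"
  proof
    assume "g [^]\<^bsub>R\<^esub> m = \<one>\<^bsub>R\<^esub>"
    then show "cls (u ^ m) = cls (v ^ m)" using e by simp
  next
    assume "cls (u ^ m) = cls (v ^ m)"
    then have "g [^]\<^bsub>R\<^esub> m \<otimes>\<^bsub>R\<^esub> cls (v ^ m) = \<one>\<^bsub>R\<^esub> \<otimes>\<^bsub>R\<^esub> cls (v ^ m)" using e by simp
    then show "g [^]\<^bsub>R\<^esub> m = \<one>\<^bsub>R\<^esub>" 
      using m_rcancel[OF nz cls_closed nat_pow_closed[OF g] one_closed] by (rule iffD1[rotated])
  qed
  finally show ?thesis using reduction_Fract[OF assms(2)] by (simp add: g_def poly_class_eq_iff)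
qed

lemma ord_reduction_dvd_card:
  assumes "\<not> P dvd u" "\<not> P dvd v"
  shows "group.ord (units_of R) (reduction P (Fraction_Field.Fract u v)) dvd CARD('a) ^ Polynomial.degree P - 1"
proof -
  \<comment> \<open>Lagrange for the fraction w/1. Taking w = \<open>u\<close> and w =
    \<open>v\<close> and subtracting removes the 1.\<close>
  have "P dvd w ^ (CARD('a) ^ Polynomial.degree P - 1) - 1" if "\<not> P dvd w" for w
    using ord_reduction_dvd_iff[OF that not_dvd_1]
      units.ord_dvd_group_order[of "reduction P (Fraction_Field.Fract w 1)"] order_units
      that cls_in_units_iff reduction_Fract[OF not_dvd_1, of w]
    by (simp add: cls_one)
  from dvd_diff[OF this[OF assms(1)] this[OF assms(2)]] show ?thesis
    by (simp add: ord_reduction_dvd_iff[OF assms])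
qed

end

text \<open>Roots of unity in K are constants: prime factors of \<open>v\<close> also divide
  \<open>u\<close> and can be cancelled one at a time, until \<open>v\<close> is constant and then
  \<open>u\<close> is too.\<close>

lemma power_eq_imp_smult:
  fixes u v :: "'a::{field, finite} poly"
  assumes "u ^ m = v ^ m" "0 < m" "v \<noteq> 0"
  shows "\<exists>c. u = Polynomial.smult c v"
  using assms
proof (induction "Polynomial.degree v" arbitrary: u v rule: less_induct)
  case less
  show ?case
  proof (cases "Polynomial.degree v = 0")
    case True
    have "Polynomial.degree u * m = Polynomial.degree v * m"
      using less.prems(1) by (metis Polynomial.degree_power_eq degree_power_eq mult.commute less.prems power_eq_0_iff)
    then have "Polynomial.degree u = 0" using True less.prems(2) by simp
    then obtain b c where "u = [:b:]" "v = [:c:]" using True by (metis degree_eq_zeroE)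
    then show ?thesis using less.prems(3) by (intro exI[of _ "b / c"]) simp
  next
    case False
    then obtain P where P: "P \<in> monic_irreducibles" "P dvd v"
      using ex_monic_irreducible_factor[of v] by auto
    note pe = monic_irreducible_imp_prime_elem[OF P(1)]
    have "v dvd v ^ m" using less.prems(2) by simp
    then have "P dvd u ^ m" using P(2) less.prems(1) dvd_trans by simp
    then have "P dvd u" using prime_elem_dvd_power[OF pe] by blast
    then obtain u' v' where uv: "u = P * u'" "v = P * v'" using P(2) by (auto simp: dvd_def)
    have P0: "P \<noteq> 0" using P(1) by (rule monic_irreducible_nonzero)
    have "0 < Polynomial.degree P" using P(1) degree_irreducible_pos by (auto simp: monic_irreducibles_def)
    moreover have "v' \<noteq> 0" using uv less.prems by auto
    ultimately have "Polynomial.degree v' < Polynomial.degree v"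
      using P0 by (simp add: uv Polynomial.degree_mult_eq)
    moreover have "u' ^ m = v' ^ m" using less.prems(1) P0 by (simp add: uv power_mult_distrib)
    ultimately obtain c where "u' = Polynomial.smult c v'"
      using less.hyps less.prems(2) \<open>v' \<noteq> 0\<close> by blast
    then show ?thesis using uv by auto
  qed
qed

text \<open>This is where nonconstancy of the fraction enters; it makes the degree bound on prime
  divisors applicable.\<close>

lemma power_diff_nonzero:
  fixes u v :: "'a::{field, finite} poly"
  assumes "v \<noteq> 0" "Fraction_Field.Fract u v \<notin> const_field" "0 < m"
  shows "u ^ m - v ^ m \<noteq> 0"
proof
  assume "u ^ m - v ^ m = 0"
  then obtain c where c: "u = Polynomial.smult c v" using power_eq_imp_smult[of u m v] assms by auto
  have "Fraction_Field.Fract u v = Fraction_Field.Fract [:c:] 1"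
    using assms(1) by (simp add: c eq_fract)
  then show False using assms(2) by (auto simp: const_field_def)
qed

section \<open>Divisors of the order\<close>

text \<open>Choose a prime l whose exponent in \<open>r\<close> is smaller than its exponent e in
  \<open>d\<close>. As l has exponent at least (j+1)e in \<open>M\<close>, its exponent in M/r
  exceeds je, hence is at least j.\<close>

lemma dvd_div_prime_power_of_not_dvd:
  fixes d M r j :: nat
  assumes "d ^ Suc j dvd M" "0 < M" "r dvd M" "\<not> d dvd r"
  shows "\<exists>l\<in>prime_factors d. l ^ j dvd M \<and> r dvd M div l ^ j"
proof -
  have nz: "M \<noteq> 0" "r \<noteq> 0" "d \<noteq> 0" using assms by (auto intro!: Nat.gr0I)
  obtain l where l: "Factorial_Ring.prime l" "multiplicity l r < multiplicity l d"
    using multiplicity_le_imp_dvd[of d r] nz assms(4) by (metis not_le)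
  then have "l dvd d" by (metis not_dvd_imp_multiplicity_0 not_less0)
  then have lf: "l \<in> prime_factors d" using l nz by (simp add: in_prime_factors_iff)
  obtain e where e: "M = r * e" using assms(3) by (elim dvdE)
  then have e0: "e \<noteq> 0" using nz by auto
  have "Suc j * multiplicity l d \<le> multiplicity l M"
    using dvd_imp_multiplicity_le[OF assms(1) nz(1), of l] l nz
    by (simp add: prime_elem_multiplicity_power_distrib del: power_Suc)
  also have "\<dots> = multiplicity l r + multiplicity l e"
    using l nz e0 unfolding e by (simp add: prime_elem_multiplicity_mult_distrib)
  finally have "j * multiplicity l d + multiplicity l d \<le> multiplicity l r + multiplicity l e" by simp
  moreover have "j * 1 \<le> j * multiplicity l d" using l by (intro mult_le_mono2) linarith
  ultimately have "j \<le> multiplicity l e" using l(2) by linarith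
  then have le: "l ^ j dvd e" by (rule multiplicity_dvd')
  moreover have "M div l ^ j = r * (e div l ^ j)" using e le by (simp add: div_mult_swap)
  ultimately show ?thesis using lf e by (intro bexI[of _ l]) auto
qed

text \<open>In x^n - 1 = (x - 1)(1 + x + ... + x^(n-1)) the second factor is congruent to n = d
  modulo d, because x is congruent to 1.\<close>

lemma power_dvd_power_minus_one_lift:
  fixes x d :: int and i n :: nat
  assumes "d ^ Suc i dvd x - 1" "d = int n"
  shows "d ^ Suc (Suc i) dvd x ^ n - 1"
proof -
  have "d dvd x - 1" using assms(1) by (rule dvd_trans[rotated]) simp
  then have "[x = 1] (mod d)" by (simp add: cong_iff_dvd_diff)
  then have "[(\<Sum>i<n. x ^ i) = (\<Sum>i<n. 1 ^ i)] (mod d)" by (intro cong_sum cong_pow)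
  then have "d dvd (\<Sum>i<n. x ^ i)" using assms(2) by (simp add: cong_iff_dvd_diff dvd_diff_commute)
      (metis cong_dvd_iff cong_iff_dvd_diff dvd_refl)
  then have "d ^ Suc i * d dvd (x - 1) * (\<Sum>i<n. x ^ i)" using assms(1) by (intro mult_dvd_mono)
  then show ?thesis by (simp add: power_diff_1_eq mult.commute mult.assoc)
qed

text \<open>Each further factor \<open>d\<close> in the exponent gains one factor \<open>d\<close>
  in the difference. The induction runs over the integers to avoid truncated subtraction.\<close>

lemma power_Suc_dvd_power_ord_minus_one:
  fixes d q :: nat
  assumes "0 < q"
  shows "d ^ Suc j dvd q ^ (Pocklington.ord d q * d ^ j) - 1"
proof -
  have "int d ^ Suc j dvd (int q ^ (Pocklington.ord d q * d ^ j)) - 1"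
  proof (induction j)
    case 0
    have "[q ^ Pocklington.ord d q = 1] (mod d)" by (rule ord)
    then have "[int q ^ Pocklington.ord d q = 1] (mod int d)"
      by (metis cong_int_iff of_nat_1 of_nat_power)
    then show ?case by (simp add: cong_iff_dvd_diff)
  next
    case (Suc j)
    from power_dvd_power_minus_one_lift[OF Suc refl] show ?case
      by (simp add: power_mult[symmetric] mult_ac)
  qed
  moreover have "1 \<le> q ^ (Pocklington.ord d q * d ^ j)" using assms by simp
  ultimately have "int (d ^ Suc j) dvd int (q ^ (Pocklington.ord d q * d ^ j) - 1)"
    by simp
  then show ?thesis by (simp only: int_dvd_int_iff)
qed

section \<open>Members of \<open>R_set\<close> of large degree\<close>

context
  fixes u v :: "'a::{field, finite} poly" and D :: nat
  assumes u0: "u \<noteq> 0" and v0: "v \<noteq> 0"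
    and D: "Polynomial.degree u \<le> D" "Polynomial.degree v \<le> D"
begin

lemma not_dvd_of_degree_gt:
  assumes "D < Polynomial.degree P"
  shows "\<not> P dvd u" "\<not> P dvd v"
  using dvd_imp_degree_le[of P u] dvd_imp_degree_le[of P v] u0 v0 D assms by auto

lemma in_R_set_iff:
  assumes "P \<in> monic_irreducibles" "D < Polynomial.degree P"
  shows "P \<in> R_set (Fraction_Field.Fract u v) d \<longleftrightarrow>
    d dvd group.ord (units_of (residue_ring_at P)) (reduction P (Fraction_Field.Fract u v))"
proof -
  interpret residue_field P using assms(1) by unfold_locales (simp add: monic_irreducibles_def)
  show ?thesis using val_Fract_eq_0 not_dvd_of_degree_gt[OF assms(2)] assms(1) by (simp add: R_set_def)
qed

lemma deg_count_R_set_eq_0: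
  assumes "D < N" "\<not> Pocklington.ord d (CARD('a)) dvd N"
  shows "deg_count (R_set (Fraction_Field.Fract u v) d) N = 0"
proof -
  have False if P: "P \<in> R_set (Fraction_Field.Fract u v) d" "Polynomial.degree P = N" for P
  proof -
    have mi: "P \<in> monic_irreducibles" using P(1) by (simp add: R_set_def)
    interpret residue_field P using mi by unfold_locales (simp add: monic_irreducibles_def)
    have "d dvd group.ord (units_of R) (reduction P (Fraction_Field.Fract u v))"
      using in_R_set_iff[OF mi] assms(1) P by simp
    then have "d dvd CARD('a) ^ N - 1"
      using ord_reduction_dvd_card not_dvd_of_degree_gt[of P] assms(1) P(2) by (metis dvd_trans)
    then have "[CARD('a) ^ N = 1] (mod d)"
      using cong_altdef_nat[of 1 "CARD('a) ^ N" d] by simp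
    then show False using assms(2) by (simp add: ord_divides')
  qed
  then have "{P \<in> R_set (Fraction_Field.Fract u v) d. Polynomial.degree P = N} = {}" by blast
  then show ?thesis by (simp only: deg_count_def card.empty)
qed

text \<open>A prime of degree N outside \<open>R_set\<close> lies in some \<open>?B l\<close>. There
  are at most \<open>d\<close> such sets, and N times the size of each is at most the degree of u^m
  - v^m with m = (q^N - 1)/l^j, where l is at least 2. Keeping the factor N avoids division.\<close>

lemma card_not_in_R_set_le:
  assumes "Fraction_Field.Fract u v \<notin> const_field" "0 < d" "D < N"
    and N: "N = Pocklington.ord d (CARD('a)) * d ^ j"
  shows "N * deg_count (monic_irreducibles :: 'a poly set) N
    \<le> N * deg_count (R_set (Fraction_Field.Fract u v) d) N + d * D * (CARD('a) ^ N div 2 ^ j)"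
proof -
  let ?R = "R_set (Fraction_Field.Fract u v) d"
  let ?M = "CARD('a) ^ N - 1"
  let ?B = "\<lambda>l. {P \<in> monic_irreducibles. P dvd u ^ (?M div l ^ j) - v ^ (?M div l ^ j)
    \<and> Polynomial.degree P = N}"
  have "1 < CARD('a) ^ N"
    using one_less_power[of "CARD('a)" N] two_le_CARD[where 'a = 'a] assms(3) by linarith
  then have M: "0 < ?M" by simp
  have fin: "finite {P \<in> S. Polynomial.degree P = N}" if "S \<subseteq> monic_irreducibles" for S :: "'a poly set"
    by (rule finite_subset[OF _ finite_monic_irreducibles_degree[of N]]) (use that in auto)
  have "{P \<in> monic_irreducibles. Polynomial.degree P = N}
      \<subseteq> {P \<in> ?R. Polynomial.degree P = N} \<union> (\<Union>l\<in>{l\<in>prime_factors d. l ^ j dvd ?M}. ?B l)"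
  proof (rule subsetI)
    fix P :: "'a poly" assume "P \<in> {P \<in> monic_irreducibles. Polynomial.degree P = N}"
    then have P: "P \<in> monic_irreducibles" "Polynomial.degree P = N" by auto
    interpret residue_field P using P(1) by unfold_locales (simp add: monic_irreducibles_def)
    note nd = not_dvd_of_degree_gt[OF assms(3)[folded P(2)]]
    show "P \<in> {P \<in> ?R. Polynomial.degree P = N} \<union> (\<Union>l\<in>{l\<in>prime_factors d. l ^ j dvd ?M}. ?B l)"
    proof (cases "P \<in> ?R")
      case False
      then have "\<not> d dvd group.ord (units_of R) (reduction P (Fraction_Field.Fract u v))"
        using in_R_set_iff[OF P(1)] assms(3) P(2) by blast
      \<comment> \<open>The exponent j + 1 rather than j matters: the extra factor \<open>d\<close>
        makes up for the power of l that the order may contain.\<close>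
      moreover have "d ^ Suc j dvd ?M" unfolding N by (rule power_Suc_dvd_power_ord_minus_one) simp
      ultimately obtain l where l: "l \<in> prime_factors d" "l ^ j dvd ?M"
        and "group.ord (units_of R) (reduction P (Fraction_Field.Fract u v)) dvd ?M div l ^ j"
        using dvd_div_prime_power_of_not_dvd[OF _ M] ord_reduction_dvd_card[OF nd] unfolding P(2) by blast
      then have "P \<in> ?B l" using P ord_reduction_dvd_iff[OF nd] by blast
      then show ?thesis using l by blast
    qed (use P in auto)
  qed
  then have "card {P \<in> monic_irreducibles :: 'a poly set. Polynomial.degree P = N}
      \<le> card ({P \<in> ?R. Polynomial.degree P = N} \<union> (\<Union>l\<in>{l\<in>prime_factors d. l ^ j dvd ?M}. ?B l))"
    by (rule card_mono[rotated]) (auto intro!: fin[of ?R, unfolded R_set_def] fin simp: R_set_def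
        intro: finite_subset[OF _ fin[OF subset_refl]])
  also have "\<dots> \<le> card {P \<in> ?R. Polynomial.degree P = N} + (\<Sum>l | l \<in> prime_factors d \<and> l ^ j dvd ?M. card (?B l))"
    by (rule order_trans[OF card_Un_le add_left_mono[OF card_UN_le]]) simp
  finally have "N * deg_count (monic_irreducibles :: 'a poly set) N
      \<le> N * deg_count ?R N + (\<Sum>l | l \<in> prime_factors d \<and> l ^ j dvd ?M. N * card (?B l))"
    by (simp add: deg_count_def sum_distrib_left[symmetric] distrib_left[symmetric])
  also have "(\<Sum>l | l \<in> prime_factors d \<and> l ^ j dvd ?M. N * card (?B l))
      \<le> (\<Sum>l | l \<in> prime_factors d \<and> l ^ j dvd ?M. D * (CARD('a) ^ N div 2 ^ j))"
  proof (rule sum_mono)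
    fix l assume "l \<in> {l. l \<in> prime_factors d \<and> l ^ j dvd ?M}"
    then have l: "l \<in> prime_factors d" "l ^ j dvd ?M" by auto
    let ?k = "?M div l ^ j"
    have l2: "2 \<le> l" using l(1) by (metis in_prime_factors_imp_prime prime_ge_2_nat)
    have k: "0 < ?k" using l(2) M by (metis div_greater_zero_iff dvd_imp_le l2 not_numeral_le_zero zero_less_iff_neq_zero zero_less_power)
    have "Polynomial.degree (u ^ ?k - v ^ ?k) \<le> D * ?k"
      by (rule degree_diff_le; rule order_trans[OF degree_power_le]) (use D in \<open>simp_all add: mult_le_mono\<close>)
    moreover have "?k \<le> CARD('a) ^ N div 2 ^ j"
    proof -
      have "?k \<le> ?M div 2 ^ j" using l2 by (intro div_le_mono2 power_mono) auto
      also have "\<dots> \<le> CARD('a) ^ N div 2 ^ j" by (intro div_le_mono) simp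
      finally show ?thesis .
    qed
    moreover have "N * card (?B l) \<le> Polynomial.degree (u ^ ?k - v ^ ?k)"
      by (rule card_monic_irreducible_divisors_le[OF power_diff_nonzero[OF v0 assms(1) k]])
    ultimately show "N * card (?B l) \<le> D * (CARD('a) ^ N div 2 ^ j)"
      by (meson le_trans mult_le_mono2)
  qed
  also have "\<dots> \<le> d * D * (CARD('a) ^ N div 2 ^ j)"
  proof -
    have "{l. l \<in> prime_factors d \<and> l ^ j dvd ?M} \<subseteq> {1..d}"
      using assms(2) by (auto simp: in_prime_factors_iff dvd_imp_le intro: Suc_leI prime_gt_0_nat)
    then have "card {l. l \<in> prime_factors d \<and> l ^ j dvd ?M} \<le> d"
      by (metis card_atLeastAtMost card_mono diff_Suc_1 finite_atLeastAtMost One_nat_def)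
    then show ?thesis by simp
  qed
  finally show ?thesis by simp
qed

end

section \<open>Densities\<close>

lemma sum_powers_le:
  fixes q :: nat
  assumes "2 \<le> q"
  shows "(\<Sum>n=1..m. q ^ n) \<le> 2 * q ^ m"
proof (induction m)
  case (Suc m)
  have "2 * q ^ m \<le> q ^ Suc m" using assms by simp
  moreover have "(\<Sum>n=1..Suc m. q ^ n) = (\<Sum>n=1..m. q ^ n) + q ^ Suc m" by simp
  ultimately show ?case using Suc by linarith
qed simp

lemma sum_powers_div_le:
  fixes q :: real
  assumes "2 \<le> q" "1 \<le> N"
  shows "(\<Sum>n=1..N. q ^ n / n) \<le> 4 * q ^ N / N"
  using assms(2)
proof (induction N rule: dec_induct)
  case base
  then show ?case using assms by simp
next
  case (step N)
  show ?case
  \<comment> \<open>With the constant 4 the induction step needs 4(N+1) at most 3qN. This holds for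
    q and N at least 2, but fails for q = 2 and N = 1, so that step is done by hand.\<close>
  proof (cases "N = 1")
    case True
    have "2 * q \<le> q * q" using assms by simp
    have "{1..Suc N} = {1, 2}" using True by auto
    then have "(\<Sum>n=1..Suc N. q ^ n / n) = q + q * q / 2"
      by (simp add: power2_eq_square)
    moreover have "4 * q ^ Suc N / Suc N = 2 * (q * q)" using True by simp
    ultimately show ?thesis using \<open>2 * q \<le> q * q\<close> assms(1) by linarith
  next
    case False
    then have N: "2 \<le> real N" using step by simp
    have "4 * (real N + 1) \<le> 3 * 2 * real N" using N by simp
    also have "\<dots> \<le> 3 * q * real N" using assms N by (intro mult_right_mono) auto
    finally have "4 * q ^ N * (real N + 1) \<le> 3 * q ^ Suc N * real N"
      using mult_left_mono[of _ _ "q ^ N"] assms by (fastforce simp: algebra_simps)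
    moreover have "0 < real N" "0 < real N + 1" using N by simp_all
    ultimately have "4 * q ^ N / real N \<le> 3 * q ^ Suc N / (real N + 1)"
      by (simp only: pos_divide_le_eq pos_le_divide_eq times_divide_eq_left)
    then have "4 * q ^ N / N \<le> 3 * q ^ Suc N / Suc N" by (simp only: of_nat_Suc add.commute)
    moreover have "(\<Sum>n=1..Suc N. q ^ n / n) \<le> 4 * q ^ N / N + q ^ Suc N / Suc N"
      using step.IH by simp
    ultimately show ?thesis by linarith
  qed
qed

text \<open>The small degrees contribute at most 2 q^(N div 2), which is at most half of q^N because
  4 is at most q^2 and 2 + N div 2 is at most N. The last inequality is why N starts at 3.\<close>

lemma power_CARD_le_deg_count:
  assumes "CARD('a::{field, finite}) = CHAR('a) ^ k" "3 \<le> N"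
  shows "CARD('a) ^ N \<le> 2 * N * deg_count (monic_irreducibles :: 'a poly set) N"
proof -
  have c2: "2 \<le> CARD('a)" by (rule two_le_CARD)
  have "4 * CARD('a) ^ (N div 2) \<le> CARD('a) ^ 2 * CARD('a) ^ (N div 2)"
    using power_mono[OF c2, of 2] by (intro mult_right_mono) auto
  also have "\<dots> = CARD('a) ^ (2 + N div 2)" by (simp only: power_add)
  also have "\<dots> \<le> CARD('a) ^ N" using c2 assms(2) by (intro power_increasing) auto
  finally show ?thesis
    using degree_count_monic_irreducibles_ge[OF assms(1), of N] assms(2)
      sum_powers_le[OF c2, of "N div 2"] by linarith
qed

text \<open>The constant 8 is 4 from \<open>sum_powers_div_le\<close> times 2 from
  \<open>power_CARD_le_deg_count\<close>.\<close>

lemma sum_deg_count_le: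
  assumes "CARD('a::{field, finite}) = CHAR('a) ^ k" "3 \<le> N"
  shows "(\<Sum>n=1..N. deg_count (monic_irreducibles :: 'a poly set) n)
    \<le> 8 * deg_count (monic_irreducibles :: 'a poly set) N"
proof -
  let ?I = "deg_count (monic_irreducibles :: 'a poly set)"
  have "real (\<Sum>n=1..N. ?I n) = (\<Sum>n=1..N. real (?I n))" by simp
  also have "\<dots> \<le> (\<Sum>n=1..N. real (CARD('a)) ^ n / n)"
  proof (rule sum_mono)
    fix n assume n: "n \<in> {1..N}"
    then have "real (n * ?I n) \<le> real (CARD('a) ^ n)"
      using degree_count_monic_irreducibles_le[of n, where 'a = 'a] by (intro of_nat_mono) auto
    then show "real (?I n) \<le> real (CARD('a)) ^ n / n" using n by (simp add: field_simps)
  qed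
  also have "\<dots> \<le> 4 * real (CARD('a)) ^ N / N"
    using two_le_CARD[where 'a = 'a] assms(2) by (intro sum_powers_div_le) auto
  also have "\<dots> \<le> 8 * real (?I N)"
  proof -
    have "real (CARD('a) ^ N) \<le> real (2 * N * ?I N)"
      using power_CARD_le_deg_count[OF assms] by (intro of_nat_mono)
    then show ?thesis using assms(2) by (simp add: field_simps)
  qed
  finally have "real (\<Sum>n=1..N. ?I n) \<le> real (8 * ?I N)" by simp
  then show ?thesis by (simp only: of_nat_le_iff)
qed

section \<open>Two criteria for ratios with periodic gaps to diverge\<close>

lemma no_limit_of_gaps:
  fixes I S :: "nat \<Rightarrow> nat" and f :: nat and \<delta> :: real
  assumes f: "2 \<le> f"
    and I: "\<And>N. N0 \<le> N \<Longrightarrow> 0 < I N"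
    and S0: "\<And>N. N0 \<le> N \<Longrightarrow> \<not> f dvd N \<Longrightarrow> S N = 0"
    and S1: "\<And>K. \<exists>N\<ge>K. I N \<le> 2 * S N"
  shows "\<not> (\<lambda>N. real (S N) / real (I N)) \<longlonglongrightarrow> \<delta>"
proof
  assume "(\<lambda>N. real (S N) / real (I N)) \<longlonglongrightarrow> \<delta>"
  from LIMSEQ_D[OF this, of "1/8"] obtain K
    where K: "\<And>N. K \<le> N \<Longrightarrow> \<bar>real (S N) / real (I N) - \<delta>\<bar> < 1/8" by auto
  \<comment> \<open>A large index that is not a multiple of \<open>f\<close>, where the ratio is 0.
    It puts the limit within 1/8 of 0, whereas ratios of at least 1/2 also occur beyond
    \<open>K\<close>.\<close>
  define m where "m = f * (K + N0) + 1"
  have "1 * (K + N0) \<le> f * (K + N0)" using f by (intro mult_le_mono1) linarith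
  then have "K + N0 \<le> m" by (simp only: m_def mult_1 trans_le_add1)
  then have m: "K \<le> m" "N0 \<le> m" by simp_all
  have "\<not> f dvd m" using f by (simp only: m_def dvd_add_right_iff dvd_triv_left) simp
  then have "\<bar>\<delta>\<bar> < 1/8" using K[OF m(1)] S0[OF m(2)] by simp
  moreover obtain N where N: "K + N0 \<le> N" "I N \<le> 2 * S N" using S1 by blast
  have "real (I N) \<le> real (2 * S N)" using N by (intro of_nat_mono)
  then have "1/2 \<le> real (S N) / real (I N)" using I[of N] N(1) by (simp add: field_simps)
  moreover have "\<bar>real (S N) / real (I N) - \<delta>\<bar> < 1/8" using K N(1) by simp
  ultimately show False by linarith
qed

text \<open>From a multiple m of \<open>f\<close> to m + 1 the numerator stays the same while the
  denominator grows by a factor of at least 8/7. This rules out a positive limit, yet the ratio is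
  at least 1/16 infinitely often.\<close>

lemma no_partial_sum_limit_of_gaps:
  fixes I S :: "nat \<Rightarrow> nat" and f :: nat and \<delta> :: real
  assumes f: "2 \<le> f"
    and I: "\<And>N. N0 \<le> N \<Longrightarrow> 0 < I N"
    and C: "\<And>N. N0 \<le> N \<Longrightarrow> (\<Sum>n=1..N. I n) \<le> 8 * I N"
    and S0: "\<And>N. N0 \<le> N \<Longrightarrow> \<not> f dvd N \<Longrightarrow> S N = 0"
    and S1: "\<And>K. \<exists>N\<ge>K. I N \<le> 2 * S N"
  shows "\<not> (\<lambda>N. real (\<Sum>n=1..N. S n) / real (\<Sum>n=1..N. I n)) \<longlonglongrightarrow> \<delta>"
proof
  define B C' where "B N = real (\<Sum>n=1..N. S n)" and "C' N = real (\<Sum>n=1..N. I n)" for N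
  assume "(\<lambda>N. real (\<Sum>n=1..N. S n) / real (\<Sum>n=1..N. I n)) \<longlonglongrightarrow> \<delta>"
  then have "(\<lambda>N. B N / C' N) \<longlonglongrightarrow> \<delta>" by (simp only: B_def C'_def)
  \<comment> \<open>For a tolerance e, the drop gives 8(\<delta> - e) \<le> 7(\<delta> + e), so
    \<delta> \<le> 15e. With e = 1/300 this is 1/20, and 1/20 + e is still below 1/16.\<close>
  from LIMSEQ_D[OF this, of "1/300"] obtain K
    where K: "\<And>N. K \<le> N \<Longrightarrow> \<bar>B N / C' N - \<delta>\<bar> < 1/300" by auto
  have C'_ge: "real (I N) \<le> C' N" if "1 \<le> N" for N
    unfolding C'_def using that by (intro of_nat_mono member_le_sum) auto
  have C'_le: "C' N \<le> 8 * real (I N)" if "N0 \<le> N" for N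
    using of_nat_mono[OF C[OF that], where 'a = real] by (simp add: C'_def)
  define m where "m = f * (K + N0 + 1)"
  have "1 * (K + N0 + 1) \<le> f * (K + N0 + 1)" using f by (intro mult_le_mono1) linarith
  then have "K + N0 + 1 \<le> m" by (simp only: m_def mult_1)
  then have m: "K \<le> m" "N0 \<le> m" "1 \<le> m" by simp_all
  have "\<not> f dvd Suc m"
    using f by (simp only: m_def Suc_eq_plus1 dvd_add_right_iff dvd_triv_left) simp
  then have "B (Suc m) = B m" using S0[of "Suc m"] m by (simp add: B_def)
  moreover have "C' (Suc m) = C' m + real (I (Suc m))" by (simp add: C'_def)
  \<comment> \<open>The last summand is at least an eighth of the whole sum.\<close>
  then have "8 * C' m \<le> 7 * C' (Suc m)" using C'_le[of "Suc m"] m by simp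
  moreover have pos: "0 < C' m" "0 < C' (Suc m)"
    using C'_ge[of m] C'_ge[of "Suc m"] I[of m] I[of "Suc m"] m by simp_all
  moreover have "0 \<le> B m" by (simp add: B_def sum_nonneg)
  ultimately have "8 * (B (Suc m) / C' (Suc m)) \<le> 7 * (B m / C' m)"
    using mult_right_mono[of "8 * C' m" "7 * C' (Suc m)" "B m"] by (simp add: field_simps)
  then have up: "\<delta> \<le> 15/300" using K[OF m(1)] K[OF le_SucI[OF m(1)]] by linarith
  obtain N where N: "K + N0 + 1 \<le> N" "I N \<le> 2 * S N" using S1 by blast
  have "real (S N) \<le> B N" unfolding B_def using N by (intro of_nat_mono member_le_sum) auto
  moreover have "real (I N) \<le> real (2 * S N)" using N by (intro of_nat_mono)
  ultimately have "C' N \<le> 16 * B N" using C'_le[of N] N by simp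
  moreover have "0 < C' N" using C'_ge[of N] I[of N] N by simp
  ultimately have "1/16 \<le> B N / C' N" by (simp add: field_simps)
  then show False using up K[of N] N by simp
qed

theorem theorem7p1:
  fixes p k q d f :: nat
    and a :: "'a::{field, finite} poly fract"
  assumes "Factorial_Ring.prime p" and "0 < k" and "q = p ^ k"
    and "CARD('a) = q"
    and "2 \<le> d" and "\<not> p dvd d"
    and "a \<noteq> 0" and "a \<notin> const_field"
    and "f = ord d q" and "2 \<le> f"
  shows "(\<nexists>\<delta>. has_d1_density (R_set a d) \<delta>) \<and> (\<nexists>\<delta>. has_d2_density (R_set a d) \<delta>)"
proof -
  let ?I = "deg_count (monic_irreducibles :: 'a poly set)"
  \<comment> \<open>The counting lemmas need q as a power of the characteristic; the characteristic
    is a prime dividing p^k, hence equals \<open>p\<close>.\<close>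
  have "Factorial_Ring.prime CHAR('a)"
    using prime_CHAR_semidom[where 'a = 'a] finite_imp_CHAR_pos[where 'a = 'a] by simp
  moreover have "CHAR('a) dvd p ^ k" using CHAR_dvd_CARD[where 'a = 'a] assms(3,4) by simp
  ultimately have "CHAR('a) = p" using assms(1) by (metis prime_dvd_power primes_dvd_imp_eq)
  then have card: "CARD('a) = CHAR('a) ^ k" using assms(3,4) by simp
  obtain u v where uv: "a = Fraction_Field.Fract u v" "v \<noteq> 0" by (cases a) auto
  then have u0: "u \<noteq> 0" using assms(7) by (auto simp: fract_collapse)
  define D where "D = max (Polynomial.degree u) (Polynomial.degree v)"
  have D: "Polynomial.degree u \<le> D" "Polynomial.degree v \<le> D" by (simp_all add: D_def)
  \<comment> \<open>Large enough both to exceed \<open>D\<close> and to be at least 3, as the lower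
    bound for I_N requires.\<close>
  define N0 where "N0 = D + 4"
  have fq: "f = ord d (CARD('a))" using assms(4,9) by simp
  have I: "0 < ?I N" if "N0 \<le> N" for N
  proof (rule ccontr)
    assume "\<not> 0 < ?I N"
    then show False
      using power_CARD_le_deg_count[OF card, of N] that zero_less_power[OF zero_less_card_finite[where 'a = 'a], of N]
      by (simp add: N0_def)
  qed
  have C: "(\<Sum>n=1..N. ?I n) \<le> 8 * ?I N" if "N0 \<le> N" for N
    using that by (intro sum_deg_count_le[OF card]) (simp add: N0_def)
  have S0: "deg_count (R_set a d) N = 0" if "N0 \<le> N" "\<not> f dvd N" for N
    using that deg_count_R_set_eq_0[OF u0 uv(2) D] by (simp add: fq uv(1) N0_def)
  have S1: "\<exists>N\<ge>K. ?I N \<le> 2 * deg_count (R_set a d) N" for K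
  proof -
    \<comment> \<open>The first two summands push N beyond \<open>K\<close> and \<open>N0\<close>,
      since j < 2^j \<le> d^j \<le> N. The third gives 4dD \<le> 2^j, so the error term is at most
      q^N/4, which is at most half of N I_N.\<close>
    define j where "j = K + N0 + 4 * d * D"
    define N where "N = f * d ^ j"
    have "j < 2 ^ j" by (rule less_exp)
    also have "2 ^ j \<le> d ^ j" using assms(5) by (intro power_mono) auto
    also have "\<dots> \<le> N" using assms(10) by (simp add: N_def)
    finally have jN: "j < N" .
    then have N: "K \<le> N" "N0 \<le> N" by (simp_all add: j_def)
    have "4 * d * D \<le> j" by (simp add: j_def)
    then have "4 * d * D \<le> 2 ^ j" using less_exp[of j] by linarith
    then have "4 * (d * D * (CARD('a) ^ N div 2 ^ j)) \<le> 2 ^ j * (CARD('a) ^ N div 2 ^ j)"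
      by (simp add: mult.assoc[symmetric] mult_le_mono1)
    also have "\<dots> \<le> CARD('a) ^ N" by simp
    also have "\<dots> \<le> 2 * N * ?I N" using N by (intro power_CARD_le_deg_count[OF card]) (simp add: N0_def)
    finally have "4 * (d * D * (CARD('a) ^ N div 2 ^ j)) \<le> 2 * (N * ?I N)"
      by (simp only: mult.assoc)
    moreover have "N * ?I N \<le> N * deg_count (R_set a d) N + d * D * (CARD('a) ^ N div 2 ^ j)"
      using card_not_in_R_set_le[OF u0 uv(2) D, of d N j] assms(5,8) N
      by (simp add: uv(1) N_def fq N0_def)
    ultimately have "N * ?I N \<le> 2 * (N * deg_count (R_set a d) N)" by linarith
    then have "N * ?I N \<le> N * (2 * deg_count (R_set a d) N)" by (simp only: mult.left_commute)
    then have "?I N \<le> 2 * deg_count (R_set a d) N" using jN by simp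
    then show ?thesis using N by blast
  qed
  show ?thesis
    unfolding has_d1_density_def has_d2_density_def
    using no_limit_of_gaps[OF assms(10) I S0 S1] no_partial_sum_limit_of_gaps[OF assms(10) I C S0 S1]
    by blast
qed

end
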